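(* Let $X$ be a real Hilbert space with inner product $(\cdot,\cdot)_X$ and dual $X'$, and let $F:X\to X'$ satisfy: (F1) there is $L_F>0$ with $|\langle F(u)-F(v),w\rangle|\le L_F\|u-v\|_X\|w\|_X$ for all $u,v,w\in X$; (F2) there is $\nu>0$ with $\nu\|u-v\|_X^2\le\langle F(u)-F(v),u-v\rangle$ for all $u,v\in X$. Let $X_N\subset X$ be a finite-dimensional subspace, and let $\{u_N^n\}_{n\ge0}\subset X_N$ be a sequence of iterative linearization Galerkin approximations (defined in the context). Let $\psi_N:X\to X_N$ be defined by $$(\psi_N(w),v)_X=\langle F(w),v\rangle\qquad\forall v\in X_N,\ w\in X.$$ For $n\ge0$ let $\eta(u_N^{n+1})$ be a real number such that $$\sup_{w\in X,\ \|w\|_X=1}\left\{(\psi_N(u_N^{n+1}),w)_X-\langle F(u_N^{n+1}),w\rangle\right\}\le\eta(u_N^{n+1}).$$ Then, with $u^\star\in X$ the unique solution of $F(u^\star)=0$ in $X'$, $$\|u^\star-u_N^{n+1}\|_X\le\frac1\nu\left(\eta(u_N^{n+1})+\|\psi_N(u_N^{n+1})\|_X\right).$$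
   Context: $\langle\cdot,\cdot\rangle$ denotes the duality pairing in $X'\times X$, and $\|\cdot\|_X$ the norm induced by $(\cdot,\cdot)_X$. Iterative linearization Galerkin approximations: for each $u\in X$ let $A(u):X\to X'$ be linear and invertible with $a(u;v,w):=\langle A(u)v,w\rangle$ satisfying $a(u;v,v)\ge\alpha\|v\|_X^2$ and $a(u;v,w)\le\beta\|v\|_X\|w\|_X$ for all $u,v,w\in X$, with constants $\alpha,\beta>0$ independent of $u$; put $f(u):=A(u)u-F(u)$. Given $u_N^0\in X_N$, the sequence $\{u_N^n\}_{n\ge0}\subset X_N$ is defined by $a(u_N^n;u_N^{n+1},v)=\langle f(u_N^n),v\rangle$ for all $v\in X_N$, $n\ge0$. *)

theory Defs
  imports "HOL-Analysis.Analysis"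
begin

text \<open>
  The dual X' of X is the type of bounded linear functionals on X, so the duality pairing of
  \<open>g\<close> in X' with \<open>w\<close> in X is the application \<open>blinfun_apply g w\<close>.
\<close>

definition finite_dim_subspace :: "'a::real_vector set \<Rightarrow> bool" where
  "finite_dim_subspace S \<longleftrightarrow> subspace S \<and> (\<exists>B. finite B \<and> span B = S)"

definition lipschitz_operator :: "real \<Rightarrow> ('a::real_inner \<Rightarrow> 'a \<Rightarrow>\<^sub>L real) \<Rightarrow> bool" where
  "lipschitz_operator L F \<longleftrightarrow>
     (\<forall>u v w. \<bar>blinfun_apply (F u - F v) w\<bar> \<le> L * norm (u - v) * norm w)"

definition strongly_monotone :: "real \<Rightarrow> ('a::real_inner \<Rightarrow> 'a \<Rightarrow>\<^sub>L real) \<Rightarrow> bool" where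
  "strongly_monotone \<nu> F \<longleftrightarrow>
     (\<forall>u v. \<nu> * (norm (u - v))\<^sup>2 \<le> blinfun_apply (F u - F v) (u - v))"

text \<open>
  Boundedness of each \<open>A u\<close> is not required separately: it follows from the \<open>\<beta>\<close>-bound
  (replace \<open>w\<close> by \<open>-w\<close>).
\<close>

definition linearization_family ::
    "real \<Rightarrow> real \<Rightarrow> ('a::real_inner \<Rightarrow> 'a \<Rightarrow> 'a \<Rightarrow>\<^sub>L real) \<Rightarrow> bool" where
  "linearization_family \<alpha> \<beta> A \<longleftrightarrow>
     (\<forall>u. linear (A u) \<and> bij (A u)) \<and>
     (\<forall>u v. blinfun_apply (A u v) v \<ge> \<alpha> * (norm v)\<^sup>2) \<and>
     (\<forall>u v w. blinfun_apply (A u v) w \<le> \<beta> * norm v * norm w)"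

definition linearization_rhs ::
    "('a::real_inner \<Rightarrow> 'a \<Rightarrow> 'a \<Rightarrow>\<^sub>L real) \<Rightarrow> ('a \<Rightarrow> 'a \<Rightarrow>\<^sub>L real) \<Rightarrow> 'a \<Rightarrow> 'a \<Rightarrow>\<^sub>L real" where
  "linearization_rhs A F u = A u u - F u"

definition ilg_sequence ::
    "('a::real_inner \<Rightarrow> 'a \<Rightarrow> 'a \<Rightarrow>\<^sub>L real) \<Rightarrow> ('a \<Rightarrow> 'a \<Rightarrow>\<^sub>L real) \<Rightarrow> 'a set \<Rightarrow> (nat \<Rightarrow> 'a) \<Rightarrow> bool" where
  "ilg_sequence A F XN u \<longleftrightarrow>
     (\<forall>n. u n \<in> XN) \<and>
     (\<forall>n. \<forall>v\<in>XN. blinfun_apply (A (u n) (u (Suc n))) v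
                 = blinfun_apply (linearization_rhs A F (u n)) v)"

definition riesz_residual_map ::
    "('a::real_inner \<Rightarrow> 'a \<Rightarrow>\<^sub>L real) \<Rightarrow> 'a set \<Rightarrow> ('a \<Rightarrow> 'a) \<Rightarrow> bool" where
  "riesz_residual_map F XN \<psi> \<longleftrightarrow>
     (\<forall>w. \<psi> w \<in> XN \<and> (\<forall>v\<in>XN. inner (\<psi> w) v = blinfun_apply (F w) v))"

text \<open>
  Supremum over the unit sphere.  If X is the zero space the sphere is empty and the real-valued
  \<open>Sup\<close> is unspecified; the supremum is then taken to be 0, as is usual for dual norms.
\<close>

definition unit_sphere_sup :: "('a::real_normed_vector \<Rightarrow> real) \<Rightarrow> real" where
  "unit_sphere_sup g =
     (if {w::'a. norm w = 1} = {} then 0 else (SUP w\<in>{w. norm w = 1}. g w))"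

end

theory Submission
  imports Defs
begin

text \<open>
  The a posteriori bound is strong monotonicity tested with the error. Put \<open>v = u (Suc n)\<close> and
  \<open>e = ustar - v\<close>. Since \<open>F ustar = 0\<close>, \<open>\<nu> * (norm e)\<^sup>2\<close> is at most \<open>- F v e\<close>, which splits as
  \<open>(inner (\<psi> v) e - F v e) - inner (\<psi> v) e\<close>. By homogeneity the first part is at most
  \<open>\<eta> v * norm e\<close>, because \<open>\<eta> v\<close> bounds the residual functional on the unit sphere
  (\<open>le_unit_sphere_sup_times_norm\<close>); the second is at most \<open>norm (\<psi> v) * norm e\<close> by
  Cauchy-Schwarz. Dividing by \<open>norm e\<close> gives the claim, and when \<open>e = 0\<close> it reduces to
  \<open>\<eta> v \<ge> 0\<close>, which holds because the supremum of a linear functional over a symmetric set is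
  not negative.

  That \<open>ustar\<close> exists is Zarantonello's theorem (\<open>zarantonello\<close>): the Riesz representation
  theorem turns \<open>F\<close> into a map \<open>r\<close> of the space into itself with the same zeros, and for small
  \<open>t > 0\<close> the map \<open>u \<mapsto> u - t r(u)\<close> is a contraction, whose unique fixed point is the unique
  zero of \<open>r\<close>. The Riesz theorem itself is obtained by minimising the energy
  \<open>(norm v)\<^sup>2 / 2 - g v\<close>: the parallelogram law makes minimising sequences Cauchy, and
  stationarity at the minimiser \<open>v\<close> says \<open>inner v w = g w\<close>.
\<close>

section \<open>The Riesz representation theorem\<close>

text \<open>
  The energy is exactly quadratic, so its midpoint convexity gap is a multiple of
  \<open>(norm (v - w))\<^sup>2\<close>; two points of nearly minimal energy are therefore close to each other.
\<close>
lemma energy_midpoint_gap: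
  fixes g :: "'a::real_inner \<Rightarrow>\<^sub>L real"
  defines "J \<equiv> \<lambda>v. (norm v)\<^sup>2 / 2 - g v"
  shows "J v + J w - 2 * J ((1/2) *\<^sub>R (v + w)) = (norm (v - w))\<^sup>2 / 4"
  unfolding J_def power2_norm_eq_inner
  by (simp add: blinfun.bilinear_simps inner_simps inner_commute field_simps)

lemma energy_bounded_below:
  fixes g :: "'a::real_inner \<Rightarrow>\<^sub>L real"
  shows "- (norm g)\<^sup>2 / 2 \<le> (norm v)\<^sup>2 / 2 - g v"
proof -
  have "g v \<le> norm g * norm v"
    using norm_blinfun[of g v] by simp
  moreover have "0 \<le> (norm g - norm v)\<^sup>2"
    by simp
  ultimately show ?thesis
    by (simp add: power2_diff)
qed

text \<open>
  By \<open>energy_midpoint_gap\<close> a sequence whose energies approach the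
  infimum at rate \<open>1/(n+1)\<close> is Cauchy; by completeness it converges, and by continuity its limit
  attains the infimum.
\<close>
lemma energy_minimiser_exists:
  fixes g :: "'a::{real_inner, complete_space} \<Rightarrow>\<^sub>L real"
  obtains v where "\<And>w. (norm v)\<^sup>2 / 2 - g v \<le> (norm w)\<^sup>2 / 2 - g w"
proof -
  define J where "J = (\<lambda>v. (norm v)\<^sup>2 / 2 - g v)"
  define m where "m = Inf (range J)"
  have bdd: "bdd_below (range J)"
    unfolding J_def using energy_bounded_below by (intro bdd_belowI2)
  have m_le: "m \<le> J v" for v
    unfolding m_def using bdd by (simp add: cINF_lower)
  have "\<exists>v. J v < m + inverse (real (Suc n))" for n
    using cInf_lessD[of "range J" "m + inverse (real (Suc n))"] unfolding m_def by auto
  then obtain x where x: "J (x n) < m + inverse (real (Suc n))" for n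
    by metis
  have "Cauchy x"
    unfolding Cauchy_def
  proof (intro allI impI)
    fix e :: real assume "e > 0"
    then obtain N where N: "inverse (real (Suc N)) < e\<^sup>2 / 8"
      using reals_Archimedean[of "e\<^sup>2 / 8"] by auto
    have close: "J (x n) < m + e\<^sup>2 / 8" if "n \<ge> N" for n
    proof -
      have "inverse (real (Suc n)) \<le> inverse (real (Suc N))"
        using that by (intro le_imp_inverse_le) auto
      then show ?thesis using x[of n] N by linarith
    qed
    have "dist (x k) (x n) < e" if "k \<ge> N" "n \<ge> N" for k n
    proof -
      have "(norm (x k - x n))\<^sup>2 / 4 = J (x k) + J (x n) - 2 * J ((1/2) *\<^sub>R (x k + x n))"
        unfolding J_def by (rule energy_midpoint_gap[symmetric])
      also have "\<dots> < e\<^sup>2 / 4"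
        using close[OF that(1)] close[OF that(2)] m_le[of "(1/2) *\<^sub>R (x k + x n)"] by linarith
      finally have "(norm (x k - x n))\<^sup>2 < e\<^sup>2"
        by simp
      then show ?thesis
        using \<open>e > 0\<close> by (simp add: dist_norm power_less_imp_less_base)
    qed
    then show "\<exists>M. \<forall>k\<ge>M. \<forall>n\<ge>M. dist (x k) (x n) < e"
      by blast
  qed
  then obtain v where v: "x \<longlonglongrightarrow> v"
    using Cauchy_convergent convergent_def by blast
  have "(\<lambda>n. J (x n)) \<longlonglongrightarrow> J v"
    unfolding J_def by (intro tendsto_intros v) simp
  moreover have "(\<lambda>n. m + inverse (real (Suc n))) \<longlonglongrightarrow> m"
    using tendsto_add[OF tendsto_const LIMSEQ_inverse_real_of_nat, of m] by simp
  ultimately have "J v \<le> m"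
    by (rule LIMSEQ_le) (use x in \<open>auto intro: less_imp_le\<close>)
  with m_le have "J v \<le> J w" for w
    by (meson order_trans)
  then show ?thesis
    using that unfolding J_def by blast
qed

text \<open>
  The representing vector is the minimiser of the energy: along a line \<open>v + s *\<^sub>R w\<close> the energy
  changes by \<open>s * (inner v w - g w) + s\<^sup>2 * (norm w)\<^sup>2 / 2\<close>, which takes negative values unless the
  linear coefficient vanishes.
\<close>
lemma riesz_representation:
  fixes g :: "'a::{real_inner, complete_space} \<Rightarrow>\<^sub>L real"
  shows "\<exists>v. \<forall>w. g w = inner v w"
proof -
  obtain v where min: "\<And>w. (norm v)\<^sup>2 / 2 - g v \<le> (norm w)\<^sup>2 / 2 - g w"
    using energy_minimiser_exists by blast
  have "g w = inner v w" for w
  proof (cases "w = 0")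
    case False
    define c where "c = inner v w - g w"
    \<comment> \<open>The step that minimises the quadratic in \<open>s\<close>.\<close>
    define s where "s = - c / (norm w)\<^sup>2"
    have "(norm (v + s *\<^sub>R w))\<^sup>2 / 2 - g (v + s *\<^sub>R w)
        = (norm v)\<^sup>2 / 2 - g v + s * c + s\<^sup>2 * (norm w)\<^sup>2 / 2"
      unfolding c_def power2_norm_eq_inner
      by (simp add: blinfun.bilinear_simps inner_simps inner_commute power2_eq_square field_simps)
    then have "0 \<le> s * c + s\<^sup>2 * (norm w)\<^sup>2 / 2"
      using min[of "v + s *\<^sub>R w"] by linarith
    also have "\<dots> = - (c\<^sup>2 / (2 * (norm w)\<^sup>2))"
      using False unfolding s_def by (simp add: field_simps power2_eq_square)
    finally have "c\<^sup>2 / (2 * (norm w)\<^sup>2) \<le> 0"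
      by simp
    then have "c = 0"
      using False by (simp add: divide_le_0_iff)
    then show ?thesis unfolding c_def by simp
  qed simp
  then show ?thesis by blast
qed

section \<open>Zeros of strongly monotone Lipschitz operators\<close>

text \<open>
  The denominator \<open>L\<^sup>2 + \<nu>\<^sup>2\<close> in the step size \<open>t\<close> keeps the contraction factor in \<open>[0, 1)\<close> for
  all \<open>L\<close> and \<open>\<nu>\<close>. The more common step \<open>\<nu> / L\<^sup>2\<close> gives the squared factor \<open>1 - \<nu>\<^sup>2 / L\<^sup>2\<close>, which is
  negative when \<open>L < \<nu>\<close>, as can happen on the zero space.
\<close>
lemma zarantonello:
  fixes F :: "'a::{real_inner, complete_space} \<Rightarrow> 'a \<Rightarrow>\<^sub>L real"
  assumes lip: "lipschitz_operator L F" and mono: "strongly_monotone \<nu> F" and "\<nu> > 0"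
  shows "\<exists>!z. F z = 0"
proof -
  have "\<exists>r. \<forall>x w. F x w = inner (r x) w"
    by (intro choice allI riesz_representation)
  then obtain r where r: "F x w = inner (r x) w" for x w
    by blast
  define K where "K = L\<^sup>2 + \<nu>\<^sup>2"
  define t where "t = \<nu> / K"
  define q where "q = 1 - t * \<nu>"
  have "K > 0"
    unfolding K_def using \<open>\<nu> > 0\<close> by (simp add: add_nonneg_pos)
  then have "t > 0"
    unfolding t_def using \<open>\<nu> > 0\<close> by simp
  have q: "0 \<le> q" "q < 1"
    using \<open>K > 0\<close> \<open>t > 0\<close> \<open>\<nu> > 0\<close> unfolding q_def
    by (auto simp: t_def K_def field_simps power2_eq_square)
  have t_small: "t\<^sup>2 * L\<^sup>2 \<le> t * \<nu>"
  proof -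
    have "t\<^sup>2 * L\<^sup>2 \<le> t\<^sup>2 * K"
      unfolding K_def by (intro mult_left_mono) auto
    also have "\<dots> = t * \<nu>"
      using \<open>K > 0\<close> unfolding t_def by (simp add: power2_eq_square)
    finally show ?thesis .
  qed
  have contr: "dist (x - t *\<^sub>R r x) (y - t *\<^sub>R r y) \<le> sqrt q * dist x y" for x y
  proof -
    define d where "d = x - y"
    define \<rho> where "\<rho> = r x - r y"
    have pair: "(F x - F y) w = inner \<rho> w" for w
      unfolding \<rho>_def by (simp add: blinfun.bilinear_simps r inner_simps)
    have mono_d: "\<nu> * (norm d)\<^sup>2 \<le> inner \<rho> d"
      using mono unfolding strongly_monotone_def d_def by (metis pair)
    \<comment> \<open>Testing the Lipschitz bound with \<open>\<rho>\<close> itself makes \<open>r\<close> Lipschitz with constant \<open>L\<close>.\<close>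
    have "(norm \<rho>)\<^sup>2 \<le> L * norm d * norm \<rho>"
      using lip pair[of \<rho>] unfolding lipschitz_operator_def d_def
      by (metis abs_ge_self order_trans power2_norm_eq_inner)
    then have "norm \<rho> * norm \<rho> \<le> \<bar>L\<bar> * norm d * norm \<rho>"
      by (metis abs_ge_self mult_right_mono norm_ge_zero order_trans power2_eq_square)
    then have "norm \<rho> \<le> \<bar>L\<bar> * norm d"
      by (cases "norm \<rho> = 0") (auto simp: mult_le_cancel_right)
    then have "(norm \<rho>)\<^sup>2 \<le> (\<bar>L\<bar> * norm d)\<^sup>2"
      by (intro power_mono) auto
    then have lip_d: "(norm \<rho>)\<^sup>2 \<le> L\<^sup>2 * (norm d)\<^sup>2"
      by (simp add: power_mult_distrib)
    have "(norm (d - t *\<^sub>R \<rho>))\<^sup>2 = (norm d)\<^sup>2 - 2 * t * inner \<rho> d + t\<^sup>2 * (norm \<rho>)\<^sup>2"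
      unfolding power2_norm_eq_inner
      by (simp add: inner_simps inner_commute power2_eq_square algebra_simps)
    also have "\<dots> \<le> (norm d)\<^sup>2 - 2 * t * (\<nu> * (norm d)\<^sup>2) + t\<^sup>2 * (L\<^sup>2 * (norm d)\<^sup>2)"
      using \<open>t > 0\<close> by (intro add_mono diff_mono mult_left_mono mono_d lip_d) auto
    also have "\<dots> \<le> q * (norm d)\<^sup>2"
      using mult_right_mono[OF t_small, of "(norm d)\<^sup>2"] unfolding q_def
      by (simp add: algebra_simps)
    finally have "norm (d - t *\<^sub>R \<rho>) \<le> sqrt (q * (norm d)\<^sup>2)"
      by (rule real_le_rsqrt)
    moreover have "(x - t *\<^sub>R r x) - (y - t *\<^sub>R r y) = d - t *\<^sub>R \<rho>"
      unfolding d_def \<rho>_def by (simp add: algebra_simps)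
    ultimately show ?thesis
      by (simp only: dist_norm real_sqrt_mult real_sqrt_abs abs_norm_cancel d_def)
  qed
  have "\<exists>!z. z - t *\<^sub>R r z = z"
    using contr q by (intro banach_fix_type[where c = "sqrt q"]) auto
  moreover have "z - t *\<^sub>R r z = z \<longleftrightarrow> F z = 0" for z
  proof -
    have "F z = 0 \<longleftrightarrow> (\<forall>w. inner (r z) w = 0)"
      by (auto simp flip: r intro: blinfun_eqI)
    also have "\<dots> \<longleftrightarrow> r z = 0"
      using inner_eq_zero_iff by auto
    finally show ?thesis
      using \<open>t > 0\<close> by simp
  qed
  ultimately show ?thesis by simp
qed

section \<open>Linear functionals on the unit sphere\<close>

lemma le_unit_sphere_sup:
  fixes g :: "'a::real_normed_vector \<Rightarrow>\<^sub>L real"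
  assumes "norm w = 1"
  shows "g w \<le> unit_sphere_sup (blinfun_apply g)"
proof -
  have "bdd_above (blinfun_apply g ` {w. norm w = 1})"
  proof (intro bdd_aboveI2)
    fix w :: 'a assume "w \<in> {w. norm w = 1}"
    then show "g w \<le> norm g"
      using norm_blinfun[of g w] by simp
  qed
  then show ?thesis
    using assms by (auto simp: unit_sphere_sup_def intro: cSUP_upper)
qed

text \<open>The sphere contains \<open>- w\<close> along with \<open>w\<close>, and the functional takes opposite values there.\<close>
lemma unit_sphere_sup_nonneg:
  fixes g :: "'a::real_normed_vector \<Rightarrow>\<^sub>L real"
  shows "0 \<le> unit_sphere_sup (blinfun_apply g)"
proof (cases "{w::'a. norm w = 1} = {}")
  case False
  then obtain w :: 'a where "norm w = 1" by blast
  then show ?thesis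
    using le_unit_sphere_sup[of w g] le_unit_sphere_sup[of "- w" g]
    by (simp add: blinfun.minus_right)
qed (simp add: unit_sphere_sup_def)

lemma le_unit_sphere_sup_times_norm:
  fixes g :: "'a::real_normed_vector \<Rightarrow>\<^sub>L real"
  shows "g w \<le> unit_sphere_sup (blinfun_apply g) * norm w"
proof (cases "w = 0")
  case False
  then show ?thesis
    using le_unit_sphere_sup[of "(1 / norm w) *\<^sub>R w" g]
    by (simp add: blinfun.scaleR_right field_simps)
qed simp

section \<open>The a posteriori error estimate\<close>

text \<open>
  Adding and subtracting \<open>p\<close> splits the residual \<open>F v\<close> into a part controlled on the unit sphere
  and a part represented by \<open>p\<close>. In the application \<open>p\<close> represents \<open>F v\<close> on the discrete space, so
  the two parts measure the discretisation error and the error of the iterative solver.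
\<close>
lemma a_posteriori_error_bound:
  fixes F :: "'a::real_inner \<Rightarrow> 'a \<Rightarrow>\<^sub>L real"
  assumes mono: "strongly_monotone \<nu> F" and "\<nu> > 0" and zero: "F z = 0"
    and bound: "unit_sphere_sup (\<lambda>w. inner p w - F v w) \<le> b"
  shows "norm (z - v) \<le> 1 / \<nu> * (b + norm p)"
proof -
  define g where "g = blinfun_inner_left p - F v"
  have g: "blinfun_apply g = (\<lambda>w. inner p w - F v w)"
    unfolding g_def by (auto simp: blinfun.diff_left inner_commute)
  have b_nonneg: "0 \<le> b"
    using unit_sphere_sup_nonneg[of g] bound unfolding g by linarith
  define e where "e = z - v"
  have "\<nu> * (norm e)\<^sup>2 \<le> (F z - F v) e"
    using mono unfolding strongly_monotone_def e_def by blast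
  also have "\<dots> = g e - inner p e"
    unfolding g by (simp add: zero blinfun.minus_left)
  also have "\<dots> \<le> b * norm e + norm p * norm e"
  proof -
    have "g e \<le> b * norm e"
      using le_unit_sphere_sup_times_norm[of g e] mult_right_mono[OF bound, of "norm e"]
      unfolding g by simp
    moreover have "- inner p e \<le> norm p * norm e"
      using Cauchy_Schwarz_ineq2[of p e] by linarith
    ultimately show ?thesis by linarith
  qed
  finally have "(\<nu> * norm e) * norm e \<le> (b + norm p) * norm e"
    by (simp add: power2_eq_square algebra_simps)
  then have "\<nu> * norm e \<le> b + norm p"
    using b_nonneg by (cases "e = 0") (auto simp: mult_le_cancel_right)
  then show ?thesis
    using \<open>\<nu> > 0\<close> unfolding e_def by (simp add: field_simps)
qed

theorem theorem3p4:
  fixes F :: "'a::{real_inner, complete_space} \<Rightarrow> 'a \<Rightarrow>\<^sub>L real"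
    and A :: "'a \<Rightarrow> 'a \<Rightarrow> 'a \<Rightarrow>\<^sub>L real"
    and XN :: "'a set"
    and u :: "nat \<Rightarrow> 'a"
    and \<psi> :: "'a \<Rightarrow> 'a"
    and \<eta> :: "'a \<Rightarrow> real"
    and L\<^sub>F \<nu> \<alpha> \<beta> :: real
  assumes F1: "L\<^sub>F > 0" "lipschitz_operator L\<^sub>F F"
    and F2: "\<nu> > 0" "strongly_monotone \<nu> F"
    and XN: "finite_dim_subspace XN"
    and A: "\<alpha> > 0" "\<beta> > 0" "linearization_family \<alpha> \<beta> A"
    and u: "ilg_sequence A F XN u"
    and psi: "riesz_residual_map F XN \<psi>"
    and eta: "\<And>n. unit_sphere_sup
                (\<lambda>w. inner (\<psi> (u (Suc n))) w - blinfun_apply (F (u (Suc n))) w) \<le> \<eta> (u (Suc n))"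
  shows "(\<exists>!ustar. F ustar = 0) \<and>
         (\<forall>n. norm ((THE ustar. F ustar = 0) - u (Suc n))
                \<le> 1 / \<nu> * (\<eta> (u (Suc n)) + norm (\<psi> (u (Suc n)))))"
proof -
  have ex1: "\<exists>!z. F z = 0"
    using zarantonello F1 F2 by blast
  then have "F (THE z. F z = 0) = 0"
    by (rule theI')
  then show ?thesis
    using ex1 a_posteriori_error_bound[OF F2(2,1) _ eta] by blast
qed

end
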